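(* Let $\mathcal S$ be a generalized KM-arc of type $(0,m,t)$ in a projective plane $\Pi_q$ of order $q$. If $m$ does not divide $q-t$, then either $\mathcal S$ is a maximal arc with one point removed, or there are more than $q+1$ $t$-secants of $\mathcal S$ (and hence the $t$-secants are not concurrent).
   Context: A generalized KM-arc of type $(0,m,t)$ in a projective plane of order $q$ is a proper non-empty subset $\mathcal S$ of the points with $|\mathcal S|=q(m-1)+t$ such that every line meets $\mathcal S$ in $0$, $m$ or $t$ points. A $t$-secant is a line meeting $\mathcal S$ in exactly $t$ points. A maximal arc is a non-empty proper point set such that every line meets it in $0$ or in $d$ points for some fixed $d$. *)

theory Defs
  imports Main
begin

text \<open>Lines are identified with the sets of points incident with them.\<close>

locale projective_plane =
  fixes points :: "'p set" and lines :: "'p set set"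
  assumes line_subset: "l \<in> lines \<Longrightarrow> l \<subseteq> points"
    and join: "\<lbrakk>A \<in> points; B \<in> points; A \<noteq> B\<rbrakk> \<Longrightarrow> \<exists>!l. l \<in> lines \<and> A \<in> l \<and> B \<in> l"
    and meet: "\<lbrakk>l \<in> lines; k \<in> lines; l \<noteq> k\<rbrakk> \<Longrightarrow> \<exists>!P. P \<in> points \<and> P \<in> l \<and> P \<in> k"
    and quadrangle: "\<exists>Q\<subseteq>points. card Q = 4 \<and> (\<forall>l\<in>lines. card (l \<inter> Q) \<le> 2)"

locale projective_plane_of_order = projective_plane points lines
  for points :: "'p set" and lines :: "'p set set" +
  fixes q :: nat
  assumes card_line: "l \<in> lines \<Longrightarrow> card l = q + 1"

definition secants :: "'p set set \<Rightarrow> nat \<Rightarrow> 'p set \<Rightarrow> 'p set set" where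
  "secants lines k S = {l \<in> lines. card (l \<inter> S) = k}"

definition concurrent :: "'p set \<Rightarrow> 'p set set \<Rightarrow> bool" where
  "concurrent points K \<longleftrightarrow> (\<exists>P\<in>points. \<forall>l\<in>K. P \<in> l)"

text \<open>The size condition is stated over the integers, so that \<open>m - 1\<close> is not truncated for \<open>m = 0\<close>.\<close>

definition generalized_KM_arc ::
  "'p set \<Rightarrow> 'p set set \<Rightarrow> nat \<Rightarrow> nat \<Rightarrow> nat \<Rightarrow> 'p set \<Rightarrow> bool" where
  "generalized_KM_arc points lines q m t S \<longleftrightarrow>
     S \<noteq> {} \<and> S \<subset> points \<and>
     int (card S) = int q * (int m - 1) + int t \<and>
     (\<forall>l\<in>lines. card (l \<inter> S) \<in> {0, m, t})"

definition maximal_arc :: "'p set \<Rightarrow> 'p set set \<Rightarrow> 'p set \<Rightarrow> bool" where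
  "maximal_arc points lines M \<longleftrightarrow>
     M \<noteq> {} \<and> M \<subset> points \<and> (\<exists>d. \<forall>l\<in>lines. card (l \<inter> M) \<in> {0, d})"

end

theory Submission
  imports Defs
begin

text \<open>
  Summing \<open>card (l \<inter> S)\<close> over the lines \<open>l\<close> through a point of \<open>S\<close> shows that (for \<open>m \<noteq> t\<close>) the point
  is on exactly one \<open>t\<close>-secant; a point outside \<open>S\<close> on no \<open>t\<close>-secant would give \<open>m dvd card S\<close>,
  that is, \<open>m dvd q - t\<close>. So the \<open>t\<close>-secants cover the plane. A set \<open>K\<close> of lines covering the plane
  cuts every line \<open>k \<notin> K\<close> in all of its \<open>q + 1\<close> points, hence has at least \<open>q + 1\<close> members. In case
  of equality they cut \<open>k\<close> in distinct points, so the common point of two members of \<open>K\<close> lies on no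
  such \<open>k\<close>, and \<open>K\<close> is the pencil of that point. If the \<open>t\<close>-secants form a pencil, then its vertex is
  not in \<open>S\<close>, the sum over the pencil gives \<open>card S = (q + 1) t\<close> and hence \<open>t = m - 1\<close>, and adding the
  vertex to \<open>S\<close> yields a maximal arc of degree \<open>m\<close>.
\<close>

lemma secants_subset: "secants lines k S \<subseteq> lines"
  by (auto simp: secants_def)

context projective_plane
begin

definition line_through :: "'p \<Rightarrow> 'p \<Rightarrow> 'p set" where
  "line_through A B = (THE l. l \<in> lines \<and> A \<in> l \<and> B \<in> l)"

definition intersection_point :: "'p set \<Rightarrow> 'p set \<Rightarrow> 'p" where
  "intersection_point l k = (THE P. P \<in> points \<and> P \<in> l \<and> P \<in> k)"

definition pencil :: "'p \<Rightarrow> 'p set set" where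
  "pencil P = {l \<in> lines. P \<in> l}"

definition line_cover :: "'p set set \<Rightarrow> bool" where
  "line_cover K \<longleftrightarrow> K \<subseteq> lines \<and> points \<subseteq> \<Union>K"

lemma line_through:
  assumes "A \<in> points" "B \<in> points" "A \<noteq> B"
  shows "line_through A B \<in> lines" "A \<in> line_through A B" "B \<in> line_through A B"
  using theI'[OF join[OF assms]] by (simp_all add: line_through_def)

lemma line_through_eqI:
  assumes "l \<in> lines" "A \<in> l" "B \<in> l" "A \<noteq> B"
  shows "line_through A B = l"
  unfolding line_through_def
proof (rule the1_equality)
  show "\<exists>!l. l \<in> lines \<and> A \<in> l \<and> B \<in> l"
    using assms line_subset[of l] by (intro join) auto
qed (use assms in simp)

lemma intersection_point:
  assumes "l \<in> lines" "k \<in> lines" "l \<noteq> k"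
  shows "intersection_point l k \<in> points" "intersection_point l k \<in> l" "intersection_point l k \<in> k"
  using theI'[OF meet[OF assms]] by (simp_all add: intersection_point_def)

lemma intersection_point_eqI:
  assumes "l \<in> lines" "k \<in> lines" "l \<noteq> k" "P \<in> l" "P \<in> k"
  shows "intersection_point l k = P"
  unfolding intersection_point_def
  by (rule the1_equality[OF meet[OF assms(1-3)]]) (use assms line_subset[of l] in auto)

lemma ex_triangle:
  obtains A B C where "A \<in> points" "B \<in> points" "C \<in> points" "A \<noteq> B" "B \<noteq> C" "A \<noteq> C"
    "\<And>l. l \<in> lines \<Longrightarrow> \<not> {A, B, C} \<subseteq> l"
proof -
  obtain Q where Q: "Q \<subseteq> points" "card Q = 4" "\<And>l. l \<in> lines \<Longrightarrow> card (l \<inter> Q) \<le> 2"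
    using quadrangle by blast
  have "finite Q"
    using Q(2) by (intro card_ge_0_finite) simp
  obtain T where T: "T \<subseteq> Q" "card T = 3"
    using obtain_subset_with_card_n[of 3 Q] Q(2) by auto
  have not_collinear: "\<not> T \<subseteq> l" if "l \<in> lines" for l
  proof
    assume "T \<subseteq> l"
    then have "card T \<le> card (l \<inter> Q)"
      using T(1) \<open>finite Q\<close> by (intro card_mono) auto
    then show False
      using Q(3)[OF that] T(2) by simp
  qed
  obtain A B C where ABC: "T = {A, B, C}" "A \<noteq> B" "B \<noteq> C" "A \<noteq> C"
    using T(2) unfolding card_3_iff by blast
  have "A \<in> points" "B \<in> points" "C \<in> points"
    using T(1) Q(1) ABC(1) by auto
  then show thesis
    using that ABC(2-4) not_collinear unfolding ABC(1) by blast
qed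

lemma ex_line_avoiding: "\<exists>l\<in>lines. P \<notin> l"
proof (rule ccontr)
  assume "\<not> ?thesis"
  then have P: "P \<in> l" if "l \<in> lines" for l
    using that by blast
  obtain A B C where points: "A \<in> points" "B \<in> points" "C \<in> points"
    and distinct: "A \<noteq> B" "B \<noteq> C" "A \<noteq> C"
    and not_collinear: "\<And>l. l \<in> lines \<Longrightarrow> \<not> {A, B, C} \<subseteq> l"
    by (rule ex_triangle) blast
  note AB = line_through[OF points(1,2) distinct(1)]
    and BC = line_through[OF points(2,3) distinct(2)]
    and AC = line_through[OF points(1,3) distinct(3)]
  have sides_distinct: "line_through A B \<noteq> line_through B C" "line_through B C \<noteq> line_through A C"
    using not_collinear[OF BC(1)] AB BC AC by auto
  have "intersection_point (line_through A B) (line_through B C) = X" if "X \<in> {P, B}" for X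
    using that AB BC P sides_distinct(1) by (intro intersection_point_eqI) auto
  moreover have "intersection_point (line_through B C) (line_through A C) = X" if "X \<in> {P, C}" for X
    using that BC AC P sides_distinct(2) by (intro intersection_point_eqI) auto
  ultimately show False
    using distinct(2) by (metis insertCI)
qed

lemma bij_betw_line_through_pencil:
  assumes P: "P \<in> points" and l: "l \<in> lines" "P \<notin> l"
  shows "bij_betw (line_through P) l (pencil P)"
proof (rule bij_betw_byWitness[where f' = "intersection_point l"])
  have joined: "line_through P A \<in> lines" "P \<in> line_through P A" "A \<in> line_through P A" if "A \<in> l" for A
    using line_through[of P A] P l line_subset that by blast+
  show "\<forall>A\<in>l. intersection_point l (line_through P A) = A"
    using joined l by (metis intersection_point_eqI)
  show "line_through P ` l \<subseteq> pencil P"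
    using joined by (auto simp: pencil_def)
  have met: "k \<in> lines" "P \<in> k" "intersection_point l k \<in> l" "intersection_point l k \<in> k"
    if "k \<in> pencil P" for k
    using intersection_point[of l k] l that by (auto simp: pencil_def)
  show "\<forall>k\<in>pencil P. line_through P (intersection_point l k) = k"
    using met l by (metis line_through_eqI)
  show "intersection_point l ` pencil P \<subseteq> l"
    using met by blast
qed

lemma pencil_inter_pencil:
  assumes "P \<in> points" "A \<in> points" "P \<noteq> A"
  shows "pencil P \<inter> pencil A = {line_through P A}"
  using line_through[OF assms] line_through_eqI[OF _ _ _ assms(3)] unfolding pencil_def by blast

lemma intersection_point_image_line_cover:
  assumes K: "line_cover K" and k: "k \<in> lines" "k \<notin> K"
  shows "intersection_point k ` K = k"
proof
  have K_lines: "l \<in> lines" "k \<noteq> l" if "l \<in> K" for l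
    using K k(2) that by (auto simp: line_cover_def)
  then show "intersection_point k ` K \<subseteq> k"
    using intersection_point(2)[OF k(1)] by blast
  show "k \<subseteq> intersection_point k ` K"
  proof
    fix P assume P: "P \<in> k"
    then obtain l where l: "l \<in> K" "P \<in> l"
      using K k(1) line_subset unfolding line_cover_def by blast
    then have "intersection_point k l = P"
      using K_lines k(1) P by (intro intersection_point_eqI) auto
    then show "P \<in> intersection_point k ` K"
      using l(1) by blast
  qed
qed

end

context projective_plane_of_order
begin

lemma finite_line: "l \<in> lines \<Longrightarrow> finite l"
  using card_line by (intro card_ge_0_finite) simp

lemma order_pos: "q > 0"
proof -
  obtain A B where AB: "A \<in> points" "B \<in> points" "A \<noteq> B"
    by (rule ex_triangle)
  have "card {A, B} \<le> card (line_through A B)"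
    using line_through[OF AB] finite_line by (intro card_mono) auto
  then show ?thesis
    using card_line line_through(1)[OF AB] AB(3) by simp
qed

lemma card_pencil:
  assumes "P \<in> points"
  shows "card (pencil P) = q + 1"
proof -
  obtain l where l: "l \<in> lines" "P \<notin> l"
    using ex_line_avoiding by blast
  then show ?thesis
    using bij_betw_same_card[OF bij_betw_line_through_pencil[OF assms l]] card_line by simp
qed

lemma finite_pencil: "P \<in> points \<Longrightarrow> finite (pencil P)"
  using card_pencil by (intro card_ge_0_finite) simp

lemma finite_points: "finite points"
proof -
  obtain P where P: "P \<in> points"
    by (rule ex_triangle)
  have "A \<in> insert P (\<Union>(pencil P))" if "A \<in> points" for A
    using line_through[OF P that] by (auto simp: pencil_def)
  then have "points \<subseteq> insert P (\<Union>(pencil P))"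
    by blast
  moreover have "finite (insert P (\<Union>(pencil P)))"
    using finite_pencil[OF P] finite_line by (auto simp: pencil_def)
  ultimately show ?thesis
    by (rule finite_subset)
qed

lemma finite_lines: "finite lines"
  using finite_points line_subset by (intro finite_subset[of lines "Pow points"]) auto

lemma sum_card_pencil:
  assumes P: "P \<in> points" and T: "T \<subseteq> points"
  shows "(\<Sum>l\<in>pencil P. card (l \<inter> T)) = card T + (if P \<in> T then q else 0)"
proof -
  have "finite T"
    using T finite_points by (rule finite_subset)
  have card_through: "card {l \<in> pencil P. A \<in> l} = 1 + (if A = P then q else 0)" if "A \<in> T" for A
  proof -
    have through: "{l \<in> pencil P. A \<in> l} = pencil P \<inter> pencil A"
      by (auto simp: pencil_def)
    show ?thesis
    proof (cases "A = P")
      case True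
      then show ?thesis
        using through card_pencil[OF P] by simp
    next
      case False
      then have "pencil P \<inter> pencil A = {line_through P A}"
        using T that by (intro pencil_inter_pencil P) auto
      then show ?thesis
        using through False by simp
    qed
  qed
  have "(\<Sum>l\<in>pencil P. card (l \<inter> T)) = (\<Sum>l\<in>pencil P. card {A \<in> T. A \<in> l})"
    by (simp add: Int_def conj_commute)
  also have "\<dots> = (\<Sum>A\<in>T. 1 + (if A = P then q else 0))"
    using card_through by (intro sum_multicount_gen finite_pencil P \<open>finite T\<close>) blast
  also have "\<dots> = card T + (if P \<in> T then q else 0)"
    using \<open>finite T\<close> by (simp only: sum.distrib sum.delta card_eq_sum)
  finally show ?thesis .
qed

lemma card_line_cover_ge:
  assumes "line_cover K"
  shows "q + 1 \<le> card K"
proof -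
  have finite_K: "finite K"
    using assms finite_lines by (auto simp: line_cover_def intro: finite_subset)
  obtain P where P: "P \<in> points"
    by (rule ex_triangle)
  show ?thesis
  proof (cases "pencil P \<subseteq> K")
    case True
    then show ?thesis
      using card_mono[OF finite_K] card_pencil[OF P] by metis
  next
    case False
    then obtain k where k: "k \<in> lines" "k \<notin> K"
      by (auto simp: pencil_def)
    have "card k \<le> card K"
      using card_image_le[OF finite_K] intersection_point_image_line_cover[OF assms k] by metis
    then show ?thesis
      using card_line[OF k(1)] by simp
  qed
qed

lemma line_cover_eq_pencil:
  assumes K: "line_cover K" and card_K: "card K = q + 1"
  obtains P where "P \<in> points" "K = pencil P"
proof -
  have finite_K: "finite K"
    using card_K by (intro card_ge_0_finite) simp
  have "2 \<le> card K"
    using card_K order_pos by simp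
  then obtain x y where xy: "x \<in> K" "y \<in> K" "x \<noteq> y"
    by (meson card_2_iff' obtain_subset_with_card_n subsetD)
  have K_lines: "K \<subseteq> lines"
    using K by (simp add: line_cover_def)
  define P where "P = intersection_point x y"
  have P: "P \<in> points" "P \<in> x" "P \<in> y"
    using intersection_point[of x y] xy K_lines by (auto simp: P_def)
  have "k \<in> K" if k: "k \<in> lines" "P \<in> k" for k
  proof (rule ccontr)
    assume "k \<notin> K"
    then have "card (intersection_point k ` K) = card K"
      using intersection_point_image_line_cover[OF K k(1)] card_line[OF k(1)] card_K by simp
    then have "inj_on (intersection_point k) K"
      by (rule eq_card_imp_inj_on[OF finite_K])
    moreover have "intersection_point k x = P" "intersection_point k y = P"
      using \<open>k \<notin> K\<close> xy K_lines k P by (auto intro!: intersection_point_eqI)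
    ultimately show False
      using xy by (auto dest: inj_onD)
  qed
  then have "pencil P \<subseteq> K"
    by (auto simp: pencil_def)
  then have "pencil P = K"
    using finite_K card_K card_pencil[OF P(1)] by (intro card_subset_eq) auto
  then show thesis
    using that P(1) by blast
qed

lemma card_concurrent_le:
  assumes "concurrent points K" "K \<subseteq> lines"
  shows "card K \<le> q + 1"
proof -
  obtain P where P: "P \<in> points" "K \<subseteq> pencil P"
    using assms by (auto simp: concurrent_def pencil_def)
  show ?thesis
    using card_mono[OF finite_pencil[OF P(1)] P(2)] card_pencil[OF P(1)] by simp
qed

end

locale KM_arc = projective_plane_of_order points lines q
  for points :: "'p set" and lines :: "'p set set" and q :: nat +
  fixes m t :: nat and S :: "'p set"
  assumes generalized_KM_arc: "generalized_KM_arc points lines q m t S"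
begin

lemma arc_psubset: "S \<subset> points"
  using generalized_KM_arc by (simp add: generalized_KM_arc_def)

lemma finite_arc: "finite S"
  using arc_psubset finite_points finite_subset by blast

lemma card_arc: "card S + q = q * m + t"
proof -
  have "int (card S + q) = int (q * m + t)"
    using generalized_KM_arc by (simp add: generalized_KM_arc_def algebra_simps)
  then show ?thesis
    by (simp only: of_nat_eq_iff)
qed

lemma card_line_inter_arc:
  assumes "l \<in> lines"
  obtains (external) "card (l \<inter> S) = 0" | (m_secant) "card (l \<inter> S) = m"
    | (t_secant) "l \<in> secants lines t S"
  using generalized_KM_arc assms by (auto simp: generalized_KM_arc_def secants_def)

lemma card_line_inter_arc_through_point:
  assumes "A \<in> S" "l \<in> pencil A"
  shows "card (l \<inter> S) = (if l \<in> secants lines t S then t else m)"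
proof -
  have "l \<in> lines" "card (l \<inter> S) \<noteq> 0"
    using assms finite_arc by (auto simp: pencil_def)
  then show ?thesis
    by (cases rule: card_line_inter_arc[of l]) (auto simp: secants_def)
qed

lemma card_t_secants_through_arc_point:
  assumes "m \<noteq> t" and A: "A \<in> S"
  shows "card (pencil A \<inter> secants lines t S) = 1"
proof -
  have A_point: "A \<in> points"
    using A arc_psubset by blast
  let ?n = "card (pencil A \<inter> secants lines t S)"
  have "int (q * m + t) = (\<Sum>l\<in>pencil A. int (card (l \<inter> S)))"
    using sum_card_pencil[OF A_point, of S] arc_psubset A card_arc by (simp flip: of_nat_sum)
  also have "\<dots> = (\<Sum>l\<in>pencil A. int m + (if l \<in> secants lines t S then int t - int m else 0))"
    using card_line_inter_arc_through_point[OF A] by (intro sum.cong) auto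
  also have "\<dots> = (int q + 1) * int m + int ?n * (int t - int m)"
    using finite_pencil[OF A_point] card_pencil[OF A_point]
    by (simp add: sum.distrib flip: sum.inter_restrict)
  finally have "(int ?n - 1) * (int t - int m) = 0"
    by (simp add: algebra_simps)
  then show ?thesis
    using \<open>m \<noteq> t\<close> by simp
qed

lemma dvd_card_arc_iff: "m dvd card S \<longleftrightarrow> int m dvd int q - int t"
proof -
  have "int (card S) = int m * int q - (int q - int t)"
    using arg_cong[OF card_arc, of int] by (simp add: algebra_simps)
  then have "int m dvd int (card S) \<longleftrightarrow> int m dvd int q - int t"
    by (simp add: dvd_diff_right_iff)
  then show ?thesis
    by simp
qed

lemma outer_point_on_t_secant:
  assumes "\<not> int m dvd int q - int t" and P: "P \<in> points" "P \<notin> S"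
  obtains l where "l \<in> pencil P" "l \<in> secants lines t S" "\<not> m dvd t"
proof -
  have "(\<Sum>l\<in>pencil P. card (l \<inter> S)) = card S"
    using sum_card_pencil[OF P(1), of S] arc_psubset P(2) by auto
  then have "\<not> m dvd (\<Sum>l\<in>pencil P. card (l \<inter> S))"
    using assms(1) by (simp add: dvd_card_arc_iff)
  then obtain l where l: "l \<in> pencil P" "\<not> m dvd card (l \<inter> S)"
    using dvd_sum[of "pencil P" m "\<lambda>l. card (l \<inter> S)"] by blast
  then have "l \<in> lines"
    by (simp add: pencil_def)
  then have "l \<in> secants lines t S"
    by (cases rule: card_line_inter_arc) (use l(2) in auto)
  then show thesis
    using that l by (auto simp: secants_def)
qed

end

locale nondivisible_KM_arc = KM_arc +
  assumes not_dvd: "\<not> int m dvd int q - int t"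
begin

lemma m_neq_t: "m \<noteq> t"
proof -
  obtain P where "P \<in> points" "P \<notin> S"
    using arc_psubset by blast
  then show ?thesis
    by (rule outer_point_on_t_secant[OF not_dvd]) auto
qed

lemma t_secants_cover: "line_cover (secants lines t S)"
  unfolding line_cover_def
proof
  show "secants lines t S \<subseteq> lines"
    by (rule secants_subset)
  show "points \<subseteq> \<Union>(secants lines t S)"
  proof
    fix P assume P: "P \<in> points"
    have "pencil P \<inter> secants lines t S \<noteq> {}"
    proof (cases "P \<in> S")
      case True
      then show ?thesis
        using card_t_secants_through_arc_point[OF m_neq_t] by force
    next
      case False
      then show ?thesis
        using outer_point_on_t_secant[OF not_dvd P] by blast
    qed
    then show "P \<in> \<Union>(secants lines t S)"
      by (auto simp: pencil_def)
  qed
qed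

context
  fixes P
  assumes vertex: "P \<in> points" and t_secants_eq_pencil: "secants lines t S = pencil P"
begin

lemma vertex_not_in_arc: "P \<notin> S"
proof
  assume "P \<in> S"
  then have "card (pencil P) = 1"
    using card_t_secants_through_arc_point[OF m_neq_t, of P] t_secants_eq_pencil by simp
  then show False
    using card_pencil[OF vertex] order_pos by simp
qed

lemma m_eq_t_plus_1: "m = t + 1"
proof -
  have "card S = (\<Sum>l\<in>pencil P. card (l \<inter> S))"
    using sum_card_pencil[OF vertex, of S] arc_psubset vertex_not_in_arc by auto
  also have "\<dots> = (\<Sum>l\<in>pencil P. t)"
    unfolding t_secants_eq_pencil[symmetric] by (intro sum.cong) (auto simp: secants_def)
  finally have "q * m = q * (t + 1)"
    using card_arc card_pencil[OF vertex] by (simp add: algebra_simps)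
  then show ?thesis
    using order_pos by (simp only: mult_cancel1) simp
qed

lemma card_line_inter_insert_vertex:
  assumes l: "l \<in> lines"
  shows "card (l \<inter> insert P S) = (if P \<in> l then m else card (l \<inter> S))"
proof (cases "P \<in> l")
  case True
  then have "l \<in> secants lines t S"
    using l by (simp add: t_secants_eq_pencil pencil_def)
  then have "card (l \<inter> S) = t"
    by (simp add: secants_def)
  then show ?thesis
    using True vertex_not_in_arc finite_line[OF l] by (simp add: m_eq_t_plus_1)
qed simp

lemma insert_vertex_psubset: "insert P S \<subset> points"
proof -
  have "insert P S \<noteq> points"
  proof
    assume full: "insert P S = points"
    have "pencil P \<noteq> {}"
      using card_pencil[OF vertex] by force
    then obtain l where l: "l \<in> lines" "P \<in> l"
      by (auto simp: pencil_def)
    then have "l \<inter> insert P S = l"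
      using full line_subset by blast
    then have "m = q + 1"
      using card_line_inter_insert_vertex[OF l(1)] card_line[OF l(1)] l(2) by simp
    then show False
      using not_dvd m_eq_t_plus_1 by simp
  qed
  then show ?thesis
    using vertex arc_psubset by blast
qed

lemma maximal_arc_insert_vertex: "maximal_arc points lines (insert P S)"
proof -
  have "card (l \<inter> insert P S) \<in> {0, m}" if l: "l \<in> lines" for l
    using l
  proof (cases rule: card_line_inter_arc)
    case t_secant
    then have "P \<in> l"
      using t_secants_eq_pencil by (simp add: pencil_def)
    then show ?thesis
      using card_line_inter_insert_vertex[OF l] by simp
  qed (simp_all add: card_line_inter_insert_vertex[OF l])
  then show ?thesis
    using insert_vertex_psubset unfolding maximal_arc_def by (intro conjI exI[of _ m]) auto
qed

end

end

theorem theorem2p13: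
  fixes points :: "'p set" and lines :: "'p set set" and q m t :: nat and S :: "'p set"
  assumes "projective_plane_of_order points lines q"
    and "generalized_KM_arc points lines q m t S"
    and "\<not> int m dvd int q - int t"
  shows "(\<exists>M P. maximal_arc points lines M \<and> P \<in> M \<and> S = M - {P}) \<or>
         (card (secants lines t S) > q + 1 \<and> \<not> concurrent points (secants lines t S))"
proof -
  interpret nondivisible_KM_arc points lines q m t S
    by (intro nondivisible_KM_arc.intro KM_arc.intro KM_arc_axioms.intro
        nondivisible_KM_arc_axioms.intro assms)
  consider (equal) "card (secants lines t S) = q + 1" | (more) "card (secants lines t S) > q + 1"
    using card_line_cover_ge[OF t_secants_cover] by linarith
  then show ?thesis
  proof cases
    case equal
    then obtain P where P: "P \<in> points" "secants lines t S = pencil P"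
      using line_cover_eq_pencil[OF t_secants_cover] by blast
    have "S = insert P S - {P}"
      using vertex_not_in_arc[OF P] by blast
    then show ?thesis
      using maximal_arc_insert_vertex[OF P] by blast
  next
    case more
    then show ?thesis
      using card_concurrent_le[OF _ secants_subset, of t S] by linarith
  qed
qed

end
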